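(* Let $n,k\ge3$, $s\ge2$, $1\le t\le\frac12(6k^2-15k+10)(s-1)+1$ and $0\le\alpha<1$. Let $H$ be a connected linear $k$-graph on $n$ vertices with maximum degree $\Delta$. If $H$ contains neither a Berge-$B_s$ nor a Berge-$K_{2,t}$, then $$\rho_\alpha^2(H)\le \alpha\Delta^2+(1-\alpha)\left[\frac{(t-1)(n-1)}{(k-1)^2}+\frac{(6k^2-15k+10)(s-1)-2(t-1)}{2(k-1)}\,\Delta\right].$$
   Context: A $k$-graph ($k$-uniform hypergraph) $H$ consists of a finite vertex set $V(H)$ and a set $E(H)$ of $k$-element subsets of $V(H)$ (edges). $H$ is linear if any two distinct edges share at most one vertex. Two vertices are adjacent if some edge contains both; $H$ is connected if the graph on $V(H)$ with this adjacency relation is connected. The degree $d_v$ of a vertex $v$ is the number of edges containing $v$. For $V(H)=\{v_1,\dots,v_n\}$, the adjacency tensor $\mathcal{A}(H)=(a_{i_1\dots i_k})$ is the order-$k$, dimension-$n$ tensor with $a_{i_1\dots i_k}=\frac{1}{(k-1)!}$ if $\{v_{i_1},\dots,v_{i_k}\}\in E(H)$ and $0$ otherwise; $\mathcal{D}(H)$ is the diagonal tensor with entries $d_{i\dots i}=d_{v_i}$ and all other entries $0$. For $0\le\alpha<1$, $\mathcal{A}_\alpha(H)=\alpha\mathcal{D}(H)+(1-\alpha)\mathcal{A}(H)$. A number $\lambda\in\mathbb{C}$ is an eigenvalue of an order-$k$ dimension-$n$ tensor $\mathcal{A}=(a_{i_1\dots i_k})$ if there is a nonzero $\mathbf{x}\in\mathbb{C}^n$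 with $\sum_{i_2,\dots,i_k=1}^n a_{i i_2\dots i_k}x_{i_2}\cdots x_{i_k}=\lambda x_i^{k-1}$ for all $i$; the spectral radius is the largest modulus of an eigenvalue. $\rho_\alpha(H)$ denotes the spectral radius of $\mathcal{A}_\alpha(H)$. For a graph $G$, a hypergraph $F$ is a Berge-$G$ if there is a bijection $\varphi:E(G)\to E(F)$ with $e\subseteq\varphi(e)$ for every $e\in E(G)$; $H$ contains a Berge-$G$ if some subhypergraph of $H$ is a Berge-$G$. The $s$-book $B_s$ is the graph consisting of $s$ triangles sharing one common edge (vertices $x,y,w_1,\dots,w_s$, edges $xy$, $xw_i$, $yw_i$). $K_{2,t}$ is the complete bipartite graph with parts of sizes $2$ and $t$. *)

theory Defs
  imports "HOL-Analysis.Analysis"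
begin

section \<open>Hypergraphs\<close>

type_synonym 'a hypergraph = "'a set \<times> 'a set set"

abbreviation verts :: "'a hypergraph \<Rightarrow> 'a set" where
  "verts H \<equiv> fst H"

abbreviation edges :: "'a hypergraph \<Rightarrow> 'a set set" where
  "edges H \<equiv> snd H"

definition uniform_hypergraph :: "nat \<Rightarrow> 'a hypergraph \<Rightarrow> bool" where
  "uniform_hypergraph k H \<longleftrightarrow>
     finite (verts H) \<and> (\<forall>e\<in>edges H. e \<subseteq> verts H \<and> card e = k)"

definition linear_hypergraph :: "'a hypergraph \<Rightarrow> bool" where
  "linear_hypergraph H \<longleftrightarrow>
     (\<forall>e\<in>edges H. \<forall>f\<in>edges H. e \<noteq> f \<longrightarrow> card (e \<inter> f) \<le> 1)"

definition adjacency :: "'a hypergraph \<Rightarrow> ('a \<times> 'a) set" where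
  "adjacency H = {(u, v). \<exists>e\<in>edges H. u \<in> e \<and> v \<in> e}"

definition connected_hypergraph :: "'a hypergraph \<Rightarrow> bool" where
  "connected_hypergraph H \<longleftrightarrow>
     verts H \<noteq> {} \<and> (\<forall>u\<in>verts H. \<forall>v\<in>verts H. (u, v) \<in> (adjacency H)\<^sup>*)"

definition vertex_degree :: "'a hypergraph \<Rightarrow> 'a \<Rightarrow> nat" where
  "vertex_degree H v = card {e \<in> edges H. v \<in> e}"

definition max_degree :: "'a hypergraph \<Rightarrow> nat" where
  "max_degree H = Max (vertex_degree H ` verts H)"

section \<open>Tensors and their spectral radius\<close>

text \<open>
  A tensor of order \<open>k\<close> whose indices range over a finite set \<open>V\<close> is a function on
  index lists; only lists of length \<open>k\<close> with entries in \<open>V\<close> are relevant.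
  The tensors of a hypergraph are indexed by its vertices, without choosing an enumeration.
\<close>

type_synonym 'a tensor = "'a list \<Rightarrow> complex"

definition tensor_eigenvalue :: "nat \<Rightarrow> 'a set \<Rightarrow> 'a tensor \<Rightarrow> complex \<Rightarrow> bool" where
  "tensor_eigenvalue k V A \<mu> \<longleftrightarrow>
     (\<exists>x :: 'a \<Rightarrow> complex. (\<exists>v\<in>V. x v \<noteq> 0) \<and>
        (\<forall>i\<in>V. (\<Sum>js\<in>{js. set js \<subseteq> V \<and> length js = k - 1}.
                   A (i # js) * prod_list (map x js)) = \<mu> * x i ^ (k - 1)))"

definition tensor_spectral_radius :: "nat \<Rightarrow> 'a set \<Rightarrow> 'a tensor \<Rightarrow> real" where
  "tensor_spectral_radius k V A = Sup {cmod \<mu> | \<mu>. tensor_eigenvalue k V A \<mu>}"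

text \<open>The supremum is a maximum as soon as there is an eigenvalue.\<close>

lemma tensor_spectral_radius_attained:
  fixes A :: "'a tensor"
  assumes V: "finite V" and ex: "tensor_eigenvalue k V A \<mu>0"
  shows "\<exists>\<mu>. tensor_eigenvalue k V A \<mu> \<and> cmod \<mu> = tensor_spectral_radius k V A"
    and "\<And>\<mu>. tensor_eigenvalue k V A \<mu> \<Longrightarrow> cmod \<mu> \<le> tensor_spectral_radius k V A"
proof -
  define L where "L = {js. set js \<subseteq> V \<and> length js = k - 1}"
  define f where "f i x = (\<Sum>js\<in>L. A (i # js) * prod_list (map x js))"
    for i and x :: "'a \<Rightarrow> complex"
  define B where "B = (\<Sum>i\<in>V. \<Sum>js\<in>L. cmod (A (i # js)))"
  define K where "K = PiE UNIV (\<lambda>i. if i \<in> V then cball (0::complex) 1 else {0})"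
  define P where "P = (cball 0 B \<times> K) \<inter>
     ((\<Inter>i\<in>V. {p. f i (snd p) = fst p * snd p i ^ (k - 1)}) \<inter> (\<Union>v\<in>V. {p. cmod (snd p v) = 1}))"
  have finL: "finite L"
    unfolding L_def by (rule finite_lists_length_eq[OF V])
  have "compactin (product_topology (\<lambda>_. euclidean) UNIV) K"
    unfolding K_def compactin_PiE by auto
  then have compK: "compact K"
    by (simp add: euclidean_product_topology)
  have cont_coord: "continuous_on UNIV (\<lambda>p :: complex \<times> ('a \<Rightarrow> complex). snd p i)" for i
    by (rule continuous_on_product_then_coordinatewise) (intro continuous_intros)
  have cont_prod: "continuous_on UNIV (\<lambda>p :: complex \<times> ('a \<Rightarrow> complex). prod_list (map (snd p) js))" for js
    by (induction js) (auto intro!: continuous_intros cont_coord)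
  have "closed ((\<Inter>i\<in>V. {p. f i (snd p) = fst p * snd p i ^ (k - 1)}) \<inter> (\<Union>v\<in>V. {p. cmod (snd p v) = 1}))"
    unfolding f_def
    by (intro closed_Int closed_INT closed_UN V ballI closed_Collect_eq continuous_intros cont_prod cont_coord)
  then have compP: "compact P"
    unfolding P_def by (intro compact_Int_closed compact_Times compK compact_cball)
  have iff: "tensor_eigenvalue k V A \<mu> \<longleftrightarrow> \<mu> \<in> fst ` P" for \<mu>
  proof
    assume "tensor_eigenvalue k V A \<mu>"
    then obtain x v where x: "v \<in> V" "x v \<noteq> 0" "\<And>i. i \<in> V \<Longrightarrow> f i x = \<mu> * x i ^ (k - 1)"
      unfolding tensor_eigenvalue_def f_def L_def by auto
    define m where "m = Max ((\<lambda>i. cmod (x i)) ` V)"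
    have "m \<in> (\<lambda>i. cmod (x i)) ` V"
      unfolding m_def using V x(1) by (intro Max_in) auto
    then obtain w where w: "w \<in> V" "cmod (x w) = m" by auto
    have le_m: "cmod (x i) \<le> m" if "i \<in> V" for i
      unfolding m_def using V that by (intro Max_ge) auto
    have m: "m > 0" using le_m[OF x(1)] x(2) by (meson less_le_trans zero_less_norm_iff)
    define y where "y i = (if i \<in> V then x i / of_real m else 0)" for i
    have prod_y: "prod_list (map y js) = prod_list (map x js) / of_real m ^ length js"
      if "set js \<subseteq> V" for js
      using that m by (induction js) (auto simp: y_def field_simps)
    have f_y: "f i y = f i x / of_real m ^ (k - 1)" for i
      unfolding f_def sum_divide_distrib
      by (intro sum.cong refl) (auto simp: L_def prod_y)
    have eq: "f i y = \<mu> * y i ^ (k - 1)" if "i \<in> V" for i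
      using that by (simp add: f_y x(3)) (simp add: y_def power_divide)
    have yw: "cmod (y w) = 1" using w m by (simp add: y_def norm_divide)
    have yle: "cmod (y i) \<le> 1" for i
      using m le_m by (auto simp: y_def norm_divide)
    have prod_le: "cmod (prod_list (map y js)) \<le> 1" for js
      by (induction js) (auto simp: norm_mult yle intro!: mult_le_one)
    have "cmod \<mu> = cmod (f w y)"
      using eq[OF w(1)] yw by (simp add: norm_mult norm_power)
    also have "\<dots> \<le> (\<Sum>js\<in>L. cmod (A (w # js)))"
      unfolding f_def
      by (rule order.trans[OF norm_sum])
         (intro sum_mono, simp add: norm_mult mult_left_le prod_le)
    also have "\<dots> \<le> B"
      unfolding B_def using w(1) V by (intro member_le_sum) (auto intro!: sum_nonneg)
    finally have "cmod \<mu> \<le> B" .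
    moreover have "y \<in> K"
      using yle by (auto simp: K_def) (simp add: y_def)
    ultimately have "(\<mu>, y) \<in> P"
      using eq yw w(1) by (auto simp: P_def)
    then show "\<mu> \<in> fst ` P" by force
  next
    assume "\<mu> \<in> fst ` P"
    then obtain y v where y: "\<And>i. i \<in> V \<Longrightarrow> f i y = \<mu> * y i ^ (k - 1)" "v \<in> V" "cmod (y v) = 1"
      unfolding P_def by auto
    from y(3) have "y v \<noteq> 0" by auto
    with y(1,2) show "tensor_eigenvalue k V A \<mu>"
      unfolding tensor_eigenvalue_def f_def L_def by blast
  qed
  have S: "{cmod \<mu> | \<mu>. tensor_eigenvalue k V A \<mu>} = (\<lambda>p. cmod (fst p)) ` P"
    unfolding iff by blast
  have "compact ((\<lambda>p. cmod (fst p)) ` P)"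
    by (intro compact_continuous_image compP continuous_intros)
  moreover have "(\<lambda>p. cmod (fst p)) ` P \<noteq> {}"
    using ex unfolding iff by blast
  ultimately have "\<exists>r\<in>(\<lambda>p. cmod (fst p)) ` P. \<forall>q\<in>(\<lambda>p. cmod (fst p)) ` P. q \<le> r"
    by (rule compact_attains_sup)
  then obtain r where r: "r \<in> {cmod \<mu> | \<mu>. tensor_eigenvalue k V A \<mu>}"
      "\<forall>q\<in>{cmod \<mu> | \<mu>. tensor_eigenvalue k V A \<mu>}. q \<le> r"
    unfolding S by (elim bexE)
  have "tensor_spectral_radius k V A = r"
    unfolding tensor_spectral_radius_def by (rule cSup_eq_maximum) (use r in blast)+
  with r show "\<exists>\<mu>. tensor_eigenvalue k V A \<mu> \<and> cmod \<mu> = tensor_spectral_radius k V A"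
    and "\<And>\<mu>. tensor_eigenvalue k V A \<mu> \<Longrightarrow> cmod \<mu> \<le> tensor_spectral_radius k V A"
    by auto
qed

section \<open>The tensors of a hypergraph\<close>

definition adjacency_tensor :: "nat \<Rightarrow> 'a hypergraph \<Rightarrow> 'a tensor" where
  "adjacency_tensor k H is =
     (if length is = k \<and> set is \<in> edges H then 1 / fact (k - 1) else 0)"

definition degree_tensor :: "nat \<Rightarrow> 'a hypergraph \<Rightarrow> 'a tensor" where
  "degree_tensor k H is =
     (if is = replicate k (hd is) then of_nat (vertex_degree H (hd is)) else 0)"

definition alpha_tensor :: "nat \<Rightarrow> real \<Rightarrow> 'a hypergraph \<Rightarrow> 'a tensor" where
  "alpha_tensor k \<alpha> H is =
     of_real \<alpha> * degree_tensor k H is + of_real (1 - \<alpha>) * adjacency_tensor k H is"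

definition alpha_spectral_radius :: "nat \<Rightarrow> real \<Rightarrow> 'a hypergraph \<Rightarrow> real" where
  "alpha_spectral_radius k \<alpha> H = tensor_spectral_radius k (verts H) (alpha_tensor k \<alpha> H)"

section \<open>Berge copies of graphs\<close>

definition subhypergraph :: "'a hypergraph \<Rightarrow> 'a hypergraph \<Rightarrow> bool" where
  "subhypergraph F H \<longleftrightarrow>
     verts F \<subseteq> verts H \<and> edges F \<subseteq> edges H \<and> (\<forall>e\<in>edges F. e \<subseteq> verts F)"

text \<open>
  The graph \<open>G\<close> is taken up to isomorphism: the injection \<open>\<psi>\<close> places its vertices
  among those of \<open>F\<close>, so that \<open>e \<subseteq> \<phi> e\<close> becomes \<open>\<psi> ` e \<subseteq> \<phi> e\<close>.
\<close>

definition is_Berge :: "'b hypergraph \<Rightarrow> 'a hypergraph \<Rightarrow> bool" where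
  "is_Berge G F \<longleftrightarrow>
     (\<exists>\<psi> \<phi>. inj_on \<psi> (verts G) \<and> \<psi> ` verts G \<subseteq> verts F \<and>
        bij_betw \<phi> (edges G) (edges F) \<and> (\<forall>e\<in>edges G. \<psi> ` e \<subseteq> \<phi> e))"

definition contains_Berge :: "'a hypergraph \<Rightarrow> 'b hypergraph \<Rightarrow> bool" where
  "contains_Berge H G \<longleftrightarrow> (\<exists>F. subhypergraph F H \<and> is_Berge G F)"

text \<open>The spine of the book is \<open>{0, 1}\<close>, and \<open>2, \<dots>, s + 1\<close> are the apexes of its triangles.\<close>

definition book_graph :: "nat \<Rightarrow> nat hypergraph" where
  "book_graph s =
     ({..<s + 2}, {{0, 1}} \<union> (\<Union>i\<in>{2..<s + 2}. {{0, i}, {1, i}}))"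

definition K2_graph :: "nat \<Rightarrow> nat hypergraph" where
  "K2_graph t = ({..<t + 2}, {{i, j} | i j. i \<in> {0, 1} \<and> j \<in> {2..<t + 2}})"

end

theory Submission
  imports Defs "HOL-Combinatorics.Multiset_Permutations"
begin

text \<open>
  By the AM-GM inequality, the moduli of an eigenvector, raised to the power \<open>k - 1\<close>, form a
  subeigenvector of the nonnegative matrix \<open>\<alpha> D + (1 - \<alpha>) / (k - 1) A\<close>, where \<open>A\<close> is the adjacency
  matrix of the 2-section. Its row sums are the degrees, so the squared modulus of every eigenvalue
  is at most \<open>\<alpha> d\<^sub>i\<^sup>2 + (1 - \<alpha>) / (k - 1) S\<close> for some vertex \<open>i\<close>, where \<open>S\<close> is the sum
  of the degrees of the neighbours of \<open>i\<close>.

  To bound \<open>S\<close>, count the edges \<open>f\<close> leaving a neighbour \<open>u\<close> of \<open>i\<close>. Excluding the book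
  leaves at most \<open>C = (2 k - 3) (s - 1)\<close> common neighbours of two vertices of an edge outside that edge,
  hence at most \<open>C\<close> edges \<open>f\<close> that contain a second neighbour of \<open>i\<close>. The other \<open>f\<close> have
  \<open>k - 1\<close> vertices not adjacent to \<open>i\<close>, and such a vertex reaches at most \<open>t - 1\<close> different edges
  at \<open>i\<close> in this way, by the exclusion of \<open>K\<^sub>2\<^sub>,\<^sub>t\<close>. Reaching the same edge more than once
  again produces common neighbours of two vertices of that edge.
\<close>

section \<open>Exhibiting Berge copies\<close>

text \<open>The witness keeps all vertices of \<open>H\<close> and takes as edges exactly the image
  of \<open>\<phi>\<close>, so of the bijection only injectivity has to be supplied.\<close>

lemma contains_BergeI:
  assumes "inj_on \<psi> (verts G)" "\<psi> ` verts G \<subseteq> verts H" "inj_on \<phi> (edges G)"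
    and "\<phi> ` edges G \<subseteq> edges H" "\<And>e. e \<in> edges G \<Longrightarrow> \<psi> ` e \<subseteq> \<phi> e"
    and "\<And>e. e \<in> edges H \<Longrightarrow> e \<subseteq> verts H"
  shows "contains_Berge H G"
proof -
  have "subhypergraph (verts H, \<phi> ` edges G) H"
    using assms(4,6) by (auto simp: subhypergraph_def)
  moreover have "is_Berge G (verts H, \<phi> ` edges G)"
    unfolding is_Berge_def
    using assms by (intro exI[of _ \<psi>] exI[of _ \<phi>]) (auto simp: bij_betw_def)
  ultimately show ?thesis
    by (auto simp: contains_Berge_def)
qed

text \<open>The range \<open>{2..<m + 2}\<close> holds the vertices other than 0 and 1 in both
  \<open>book_graph m\<close> and \<open>K2_graph m\<close>; \<open>h\<close> matches them with
  members of \<open>T\<close>.\<close>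

lemma obtain_labels:
  assumes "finite T" "m \<le> card T"
  obtains h :: "nat \<Rightarrow> 'a" where "inj_on h {2..<m + 2}" "h ` {2..<m + 2} \<subseteq> T"
proof -
  obtain T' where T': "T' \<subseteq> T" "card T' = m"
    using assms by (meson obtain_subset_with_card_n)
  then have "finite T'"
    using assms(1) finite_subset by blast
  with T' have "\<exists>h. bij_betw h {2..<m + 2} T'"
    by (intro finite_same_card_bij) auto
  with T'(1) that show thesis
    by (auto simp: bij_betw_def)
qed

lemma Max_pair: "2 \<le> j \<Longrightarrow> Max {0, j} = j" "2 \<le> j \<Longrightarrow> Max {Suc 0, j} = j" for j :: nat
  by auto

text \<open>The edge \<open>e\<close> carries the spine, \<open>f w\<close> and \<open>g w\<close>
  the two sides of the triangle with apex \<open>w\<close>. Injectivity of \<open>f\<close> and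
  \<open>g\<close>, their disjoint ranges and the avoidance of \<open>e\<close> make these
  hyperedges pairwise different.\<close>

lemma contains_Berge_book:
  fixes H :: "'a hypergraph"
  assumes "e \<in> edges H" "u \<in> e" "v \<in> e" "u \<noteq> v"
    and T: "finite T" "s \<le> card T" "u \<notin> T" "v \<notin> T"
    and fg: "inj_on f T" "inj_on g T" "\<And>w w'. w \<in> T \<Longrightarrow> w' \<in> T \<Longrightarrow> f w \<noteq> g w'"
    and ne: "\<And>w. w \<in> T \<Longrightarrow> f w \<in> edges H - {e} \<and> g w \<in> edges H - {e}"
    and inc: "\<And>w. w \<in> T \<Longrightarrow> u \<in> f w \<and> w \<in> f w \<and> v \<in> g w \<and> w \<in> g w"
    and sub: "\<And>e. e \<in> edges H \<Longrightarrow> e \<subseteq> verts H"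
  shows "contains_Berge H (book_graph s)"
proof -
  obtain h where h: "inj_on h {2..<s + 2}" "h ` {2..<s + 2} \<subseteq> T"
    using obtain_labels[OF T(1,2)] .
  have hT: "h j \<in> T" if "2 \<le> j" "j < s + 2" for j
    using h(2) that by auto
  have heq: "h i = h j \<longleftrightarrow> i = j" if "2 \<le> i" "i < s + 2" "2 \<le> j" "j < s + 2" for i j
    using h(1) that by (auto simp: inj_on_eq_iff)
  have feq: "f (h i) = f (h j) \<longleftrightarrow> i = j" "g (h i) = g (h j) \<longleftrightarrow> i = j"
    if "2 \<le> i" "i < s + 2" "2 \<le> j" "j < s + 2" for i j
    using fg(1,2) heq hT that by (auto simp: inj_on_eq_iff)
  have neq: "f (h i) \<noteq> g (h j)" "g (h j) \<noteq> f (h i)" "f (h i) \<noteq> e" "g (h i) \<noteq> e"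
    if "2 \<le> i" "i < s + 2" "2 \<le> j" "j < s + 2" for i j
    using fg(3)[OF hT[OF that(1,2)] hT[OF that(3,4)]] ne[OF hT[OF that(1,2)]] by auto
  define \<psi> where "\<psi> j = (if j = 0 then u else if j = 1 then v else h j)" for j :: nat
  \<comment> \<open>A graph edge is a bare set, so its label is recovered as its maximum. The spine
    is tested first because it contains 0 too.\<close>
  define \<phi> where "\<phi> a = (if a = {0, 1} then e else if 0 \<in> a then f (h (Max a)) else g (h (Max a)))"
    for a :: "nat set"
  have \<phi>: "\<phi> {0, 1} = e" "\<And>j. 2 \<le> j \<Longrightarrow> \<phi> {0, j} = f (h j)" "\<And>j. 2 \<le> j \<Longrightarrow> \<phi> {1, j} = g (h j)"
    by (auto simp: \<phi>_def Max_pair doubleton_eq_iff)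
  have G: "edges (book_graph s) = {{0, 1}} \<union> (\<lambda>j. {0, j}) ` {2..<s + 2} \<union> (\<lambda>j. {1, j}) ` {2..<s + 2}"
    by (auto simp: book_graph_def)
  show ?thesis
  proof (rule contains_BergeI[of \<psi> _ _ \<phi>])
    show "inj_on \<psi> (verts (book_graph s))"
    proof (rule inj_onI)
      fix i j assume "i \<in> verts (book_graph s)" "j \<in> verts (book_graph s)" "\<psi> i = \<psi> j"
      then have *: "i < s + 2" "j < s + 2" "\<psi> i = \<psi> j"
        by (auto simp: book_graph_def)
      have hu: "h j \<noteq> u \<and> h j \<noteq> v" if "2 \<le> j" "j < s + 2" for j
        using hT[OF that] T(3,4) by auto
      have cases: "i = 0 \<or> i = 1 \<or> 2 \<le> i" "j = 0 \<or> j = 1 \<or> 2 \<le> j"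
        by arith+
      then show "i = j"
        using * heq[of i j] hu[of i] hu[of j] \<open>u \<noteq> v\<close> by (auto simp: \<psi>_def)
    qed
    show "\<psi> ` verts (book_graph s) \<subseteq> verts H"
    proof
      fix x assume "x \<in> \<psi> ` verts (book_graph s)"
      then obtain j where j: "j < s + 2" "x = \<psi> j"
        by (auto simp: book_graph_def)
      have "h j \<in> verts H" if "2 \<le> j"
        using hT[OF that j(1)] ne[of "h j"] inc[of "h j"] sub by blast
      moreover have "u \<in> verts H" "v \<in> verts H"
        using assms(1-3) sub by blast+
      moreover have "j = 0 \<or> j = 1 \<or> 2 \<le> j"
        by arith
      ultimately show "x \<in> verts H"
        using j by (auto simp: \<psi>_def)
    qed
    show "inj_on \<phi> (edges (book_graph s))"
    proof (rule inj_onI)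
      fix a b assume ab: "a \<in> edges (book_graph s)" "b \<in> edges (book_graph s)" "\<phi> a = \<phi> b"
      have "a = {0, 1} \<or> (\<exists>j. 2 \<le> j \<and> j < s + 2 \<and> (a = {0, j} \<or> a = {1, j}))"
        using ab(1) by (auto simp: G)
      moreover have "b = {0, 1} \<or> (\<exists>j. 2 \<le> j \<and> j < s + 2 \<and> (b = {0, j} \<or> b = {1, j}))"
        using ab(2) by (auto simp: G)
      ultimately show "a = b"
        using ab(3) by (elim disjE exE conjE; hypsubst; simp only: \<phi> feq neq not_sym[OF neq(3)] not_sym[OF neq(4)])
    qed
    show "\<phi> ` edges (book_graph s) \<subseteq> edges H"
      using ne hT \<phi> \<open>e \<in> edges H\<close> by (auto simp: G)
    show "\<psi> ` a \<subseteq> \<phi> a" if "a \<in> edges (book_graph s)" for a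
      using that inc hT \<phi> assms(1-3) by (auto simp: G \<psi>_def)
  qed (use sub in auto)
qed

text \<open>The index set \<open>T\<close> need not consist of vertices: \<open>c\<close> supplies
  the vertices of the larger part. In the application \<open>T\<close> is a set of edges at
  \<open>x\<close> and \<open>f\<close> is the identity.\<close>

lemma contains_Berge_K2:
  fixes H :: "'a hypergraph"
  assumes "x \<noteq> y" "x \<in> verts H" "y \<in> verts H"
    and T: "finite T" "t \<le> card T" 
    and c: "inj_on c T" "\<And>w. w \<in> T \<Longrightarrow> c w \<noteq> x \<and> c w \<noteq> y"
    and fg: "inj_on f T" "inj_on g T" "\<And>w w'. w \<in> T \<Longrightarrow> w' \<in> T \<Longrightarrow> f w \<noteq> g w'"
    and ne: "\<And>w. w \<in> T \<Longrightarrow> f w \<in> edges H \<and> g w \<in> edges H"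
    and inc: "\<And>w. w \<in> T \<Longrightarrow> x \<in> f w \<and> c w \<in> f w \<and> y \<in> g w \<and> c w \<in> g w"
    and sub: "\<And>e. e \<in> edges H \<Longrightarrow> e \<subseteq> verts H"
  shows "contains_Berge H (K2_graph t)"
proof -
  obtain h where h: "inj_on h {2..<t + 2}" "h ` {2..<t + 2} \<subseteq> T"
    using obtain_labels[OF T(1,2)] .
  have hT: "h j \<in> T" if "2 \<le> j" "j < t + 2" for j
    using h(2) that by auto
  have heq: "h i = h j \<longleftrightarrow> i = j" if "2 \<le> i" "i < t + 2" "2 \<le> j" "j < t + 2" for i j
    using h(1) that by (auto simp: inj_on_eq_iff)
  have feq: "f (h i) = f (h j) \<longleftrightarrow> i = j" "g (h i) = g (h j) \<longleftrightarrow> i = j" "c (h i) = c (h j) \<longleftrightarrow> i = j"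
    if "2 \<le> i" "i < t + 2" "2 \<le> j" "j < t + 2" for i j
    using fg(1,2) c(1) heq hT that by (auto simp: inj_on_eq_iff)
  have neq: "f (h i) \<noteq> g (h j)" "g (h j) \<noteq> f (h i)"
    if "2 \<le> i" "i < t + 2" "2 \<le> j" "j < t + 2" for i j
    using fg(3)[OF hT[OF that(1,2)] hT[OF that(3,4)]] by auto
  define \<psi> where "\<psi> j = (if j = 0 then x else if j = 1 then y else c (h j))" for j :: nat
  define \<phi> where "\<phi> a = (if 0 \<in> a then f (h (Max a)) else g (h (Max a)))" for a :: "nat set"
  have \<phi>: "\<And>j. 2 \<le> j \<Longrightarrow> \<phi> {0, j} = f (h j)" "\<And>j. 2 \<le> j \<Longrightarrow> \<phi> {1, j} = g (h j)"
    by (auto simp: \<phi>_def Max_pair)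
  have G: "edges (K2_graph t) = (\<lambda>j. {0, j}) ` {2..<t + 2} \<union> (\<lambda>j. {1, j}) ` {2..<t + 2}"
    unfolding K2_graph_def snd_conv by blast
  show ?thesis
  proof (rule contains_BergeI[of \<psi> _ _ \<phi>])
    show "inj_on \<psi> (verts (K2_graph t))"
    proof (rule inj_onI)
      fix i j assume "i \<in> verts (K2_graph t)" "j \<in> verts (K2_graph t)" "\<psi> i = \<psi> j"
      then have *: "i < t + 2" "j < t + 2" "\<psi> i = \<psi> j"
        by (auto simp: K2_graph_def)
      have hu: "c (h j) \<noteq> x \<and> c (h j) \<noteq> y" if "2 \<le> j" "j < t + 2" for j
        using hT[OF that] c(2) by auto
      have cases: "i = 0 \<or> i = 1 \<or> 2 \<le> i" "j = 0 \<or> j = 1 \<or> 2 \<le> j"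
        by arith+
      then show "i = j"
        using * feq(3)[of i j] hu[of i] hu[of j] \<open>x \<noteq> y\<close> by (auto simp: \<psi>_def)
    qed
    show "\<psi> ` verts (K2_graph t) \<subseteq> verts H"
    proof
      fix z assume "z \<in> \<psi> ` verts (K2_graph t)"
      then obtain j where j: "j < t + 2" "z = \<psi> j"
        by (auto simp: K2_graph_def)
      have "c (h j) \<in> verts H" if "2 \<le> j"
        using hT[OF that j(1)] ne[of "h j"] inc[of "h j"] sub by blast
      moreover have "j = 0 \<or> j = 1 \<or> 2 \<le> j"
        by arith
      ultimately show "z \<in> verts H"
        using j assms(2,3) by (auto simp: \<psi>_def)
    qed
    show "inj_on \<phi> (edges (K2_graph t))"
    proof (rule inj_onI)
      fix a b assume ab: "a \<in> edges (K2_graph t)" "b \<in> edges (K2_graph t)" "\<phi> a = \<phi> b"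
      have "(\<exists>j. 2 \<le> j \<and> j < t + 2 \<and> (a = {0, j} \<or> a = {1, j}))"
        using ab(1) by (auto simp: G)
      moreover have "(\<exists>j. 2 \<le> j \<and> j < t + 2 \<and> (b = {0, j} \<or> b = {1, j}))"
        using ab(2) by (auto simp: G)
      ultimately show "a = b"
        using ab(3) by (elim disjE exE conjE; hypsubst; simp only: \<phi> feq neq)
    qed
    show "\<phi> ` edges (K2_graph t) \<subseteq> edges H"
      using ne hT \<phi> by (auto simp: G)
    show "\<psi> ` a \<subseteq> \<phi> a" if "a \<in> edges (K2_graph t)" for a
      using that inc hT \<phi> by (auto simp: G \<psi>_def)
  qed (use sub in auto)
qed

section \<open>Linear uniform hypergraphs\<close>

text \<open>Take \<open>T\<close> of greatest cardinality. A point whose two values are both new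
  could be added without losing injectivity.\<close>

lemma ex_maximal_bi_injective:
  assumes "finite S"
  obtains T where "T \<subseteq> S" "inj_on f T" "inj_on g T" "\<And>w. w \<in> S \<Longrightarrow> f w \<in> f ` T \<or> g w \<in> g ` T"
proof -
  let ?P = "\<lambda>T. T \<subseteq> S \<and> inj_on f T \<and> inj_on g T"
  have "\<exists>T. ?P T \<and> (\<forall>T'. ?P T' \<longrightarrow> card T' \<le> card T)"
  proof (rule ex_has_greatest_nat[of ?P "{}" card "Suc (card S)"])
    show "?P {}" by simp
    show "\<forall>T. ?P T \<longrightarrow> card T < Suc (card S)"
      using assms card_mono less_Suc_eq_le by blast
  qed
  then obtain T where T: "?P T" and max: "\<And>T'. ?P T' \<Longrightarrow> card T' \<le> card T"
    by blast
  have "f w \<in> f ` T \<or> g w \<in> g ` T" if "w \<in> S" for w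
  proof (rule ccontr)
    assume *: "\<not> ?thesis"
    then have "w \<notin> T" by auto
    moreover have "?P (insert w T)"
      using * T that by auto
    then have "card (insert w T) \<le> card T"
      using max by blast
    moreover have "finite T"
      using T assms finite_subset by blast
    ultimately show False by simp
  qed
  with T that show thesis by blast
qed

section \<open>Double counting and the inequality of the means\<close>

lemma sum_card_Collect_swap:
  assumes "finite A" "finite B"
  shows "(\<Sum>a\<in>A. card {b \<in> B. R a b}) = (\<Sum>b\<in>B. card {a \<in> A. R a b})"
  unfolding card_eq_sum using assms by (rule sum.swap_restrict)

lemma card_off_diagonal:
  assumes "finite A"
  shows "card (SIGMA u:A. A - {u}) = card A * (card A - 1)"
  using assms by (simp add: card_SigmaI)

text \<open>This is AM-GM for the numbers \<open>a j ^ card S\<close>, whose geometric mean is the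
  plain product.\<close>

lemma prod_le_mean_power:
  fixes a :: "'a \<Rightarrow> real"
  assumes "finite S" "S \<noteq> {}" "\<And>j. j \<in> S \<Longrightarrow> a j \<ge> 0"
  shows "(\<Prod>j\<in>S. a j) \<le> (\<Sum>j\<in>S. a j ^ card S) / card S"
proof -
  have c: "card S > 0" using assms by (simp add: card_gt_0_iff)
  have nn: "(\<Prod>j\<in>S. a j) \<ge> 0" using assms by (intro prod_nonneg) auto
  have "(\<Prod>j\<in>S. a j ^ card S) powr (1 / card S) = (\<Prod>j\<in>S. a j)"
    using c nn by (simp add: prod_power_distrib[symmetric] powr_powr flip: powr_realpow')
  then show ?thesis
    using arith_geom_mean[of S "\<lambda>j. a j ^ card S"] assms by (simp add: sum_divide_distrib)
qed

section \<open>Basic consequences of uniformity and linearity\<close>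

locale linear_kgraph =
  fixes H :: "'a hypergraph" and k :: nat
  assumes uniform: "uniform_hypergraph k H"
    and linear: "linear_hypergraph H"
    and k3: "k \<ge> 3"
begin

lemma finite_verts: "finite (verts H)"
  using uniform by (simp add: uniform_hypergraph_def)

lemma edge_sub: "e \<in> edges H \<Longrightarrow> e \<subseteq> verts H"
  using uniform by (simp add: uniform_hypergraph_def)

lemma card_edge: "e \<in> edges H \<Longrightarrow> card e = k"
  using uniform by (simp add: uniform_hypergraph_def)

lemma finite_edges: "finite (edges H)"
  using edge_sub finite_verts by (meson Pow_iff finite_Pow_iff finite_subset subsetI)

lemma finite_edge: "e \<in> edges H \<Longrightarrow> finite e"
  using edge_sub finite_verts finite_subset by blast

lemma edge_eqI:
  assumes "e \<in> edges H" "f \<in> edges H" "u \<in> e" "v \<in> e" "u \<in> f" "v \<in> f" "u \<noteq> v"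
  shows "e = f"
proof (rule ccontr)
  assume "e \<noteq> f"
  then have "card (e \<inter> f) \<le> 1"
    using linear assms by (auto simp: linear_hypergraph_def)
  moreover have "card {u, v} \<le> card (e \<inter> f)"
    using assms finite_edge by (intro card_mono) auto
  ultimately show False
    using \<open>u \<noteq> v\<close> by simp
qed

subsection \<open>Common neighbours and degree sums\<close>

definition edges_at :: "'a \<Rightarrow> 'a set set" where
  "edges_at v = {e \<in> edges H. v \<in> e}"

lemma finite_edges_at: "finite (edges_at v)"
  using finite_edges by (simp add: edges_at_def)

lemma vertex_degree_eq: "vertex_degree H v = card (edges_at v)"
  by (simp add: vertex_degree_def edges_at_def)

text \<open>No vertex of \<open>e\<close> is excluded explicitly: if \<open>u\<close> and
  \<open>v\<close> are distinct vertices of the edge \<open>e\<close>, linearity keeps all of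
  \<open>e\<close> out.\<close>

definition outer_common_nbrs :: "'a set \<Rightarrow> 'a \<Rightarrow> 'a \<Rightarrow> 'a set" where
  "outer_common_nbrs e u v =
     {w. (\<exists>f\<in>edges_at u - {e}. w \<in> f) \<and> (\<exists>f\<in>edges_at v - {e}. w \<in> f)}"

lemma finite_outer_common_nbrs: "finite (outer_common_nbrs e u v)"
proof (rule finite_subset)
  show "outer_common_nbrs e u v \<subseteq> verts H"
    using edge_sub by (auto simp: outer_common_nbrs_def edges_at_def)
qed (rule finite_verts)

text \<open>
  A maximal family of outer common neighbours whose connecting edges are pairwise different
  spans a Berge book with spine \<open>u v\<close>, and the edges of that family
  cover all outer common neighbours.
\<close>

lemma card_outer_common_nbrs:
  assumes e: "e \<in> edges H" "u \<in> e" "v \<in> e" "u \<noteq> v"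
    and "s \<ge> 1" and book: "\<not> contains_Berge H (book_graph s)"
  shows "card (outer_common_nbrs e u v) \<le> (2 * k - 3) * (s - 1)"
proof -
  let ?S = "outer_common_nbrs e u v"
  have "\<forall>w\<in>?S. \<exists>f\<in>edges_at u - {e}. w \<in> f" "\<forall>w\<in>?S. \<exists>f\<in>edges_at v - {e}. w \<in> f"
    by (auto simp: outer_common_nbrs_def)
  then obtain f g where "\<forall>w\<in>?S. f w \<in> edges_at u - {e} \<and> w \<in> f w"
      "\<forall>w\<in>?S. g w \<in> edges_at v - {e} \<and> w \<in> g w"
    by metis
  then have f: "f w \<in> edges H" "f w \<noteq> e" "u \<in> f w" "w \<in> f w"
    and g: "g w \<in> edges H" "g w \<noteq> e" "v \<in> g w" "w \<in> g w" if "w \<in> ?S" for w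
    using that by (auto simp: edges_at_def)
  have vf: "v \<notin> f w" and ug: "u \<notin> g w" if "w \<in> ?S" for w
    using edge_eqI[of "f w" e u v] edge_eqI[of "g w" e u v] f[OF that] g[OF that] e by blast+
  have uv: "w \<noteq> u \<and> w \<noteq> v" if "w \<in> ?S" for w
    using vf[OF that] ug[OF that] f[OF that] g[OF that] by auto
  obtain T where T: "T \<subseteq> ?S" "inj_on f T" "inj_on g T"
    and max: "\<And>w. w \<in> ?S \<Longrightarrow> f w \<in> f ` T \<or> g w \<in> g ` T"
    using ex_maximal_bi_injective[OF finite_outer_common_nbrs] by metis
  have finT: "finite T"
    using T finite_outer_common_nbrs finite_subset by blast
  have "card T < s"
  proof (rule ccontr)
    assume "\<not> card T < s"
    then have "s \<le> card T" by simp
    then have "contains_Berge H (book_graph s)"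
    proof (rule contains_Berge_book[OF e finT, where f = f and g = g])
      show "u \<notin> T" "v \<notin> T"
        using uv T(1) by auto
      show "f w \<noteq> g w'" if "w \<in> T" "w' \<in> T" for w w'
        using that T(1) f(3)[of w] ug[of w'] by auto
      show "f w \<in> edges H - {e} \<and> g w \<in> edges H - {e}" if "w \<in> T" for w
        using that T(1) f(1,2)[of w] g(1,2)[of w] by auto
      show "u \<in> f w \<and> w \<in> f w \<and> v \<in> g w \<and> w \<in> g w" if "w \<in> T" for w
        using that T(1) f(3,4)[of w] g(3,4)[of w] by auto
    qed (use T edge_sub in auto)
    with book show False by simp
  qed
  have "?S \<subseteq> (\<Union>z\<in>T. (f z - {u}) \<union> (g z - {v}))"
  proof
    fix w assume w: "w \<in> ?S"
    from max[OF this] show "w \<in> (\<Union>z\<in>T. (f z - {u}) \<union> (g z - {v}))"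
      using f(4)[OF w] g(4)[OF w] uv[OF w] by auto
  qed
  then have "card ?S \<le> card (\<Union>z\<in>T. (f z - {u}) \<union> (g z - {v}))"
    using finT T(1) f(1) g(1) finite_edge by (intro card_mono) auto
  also have "\<dots> \<le> (\<Sum>z\<in>T. card ((f z - {u}) \<union> (g z - {v})))"
    by (rule card_UN_le[OF finT])
  also have "\<dots> \<le> (\<Sum>z\<in>T. 2 * k - 3)"
  proof (rule sum_mono)
    fix z assume "z \<in> T"
    then have z: "z \<in> ?S" using T(1) by blast
    have fin: "finite (f z - {u})" "finite (g z - {v})"
      using f(1)[OF z] g(1)[OF z] finite_edge by auto
    \<comment> \<open>The point \<open>z\<close> lies in both sets of size \<open>k - 1\<close>, so
      the union has at most \<open>2 * (k - 1) - 1 = 2 * k - 3\<close> elements.\<close>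
    have "card {z} \<le> card ((f z - {u}) \<inter> (g z - {v}))"
      using f(4)[OF z] g(4)[OF z] uv[OF z] fin by (intro card_mono) auto
    moreover have "card (f z - {u}) = k - 1" "card (g z - {v}) = k - 1"
      using f[OF z] g[OF z] card_edge by (simp_all add: card_Diff_singleton)
    ultimately show "card ((f z - {u}) \<union> (g z - {v})) \<le> 2 * k - 3"
      using card_Un_Int[OF fin] by simp
  qed
  also have "\<dots> = (2 * k - 3) * card T"
    by simp
  also have "\<dots> \<le> (2 * k - 3) * (s - 1)"
    using \<open>card T < s\<close> by (intro mult_le_mono) auto
  finally show ?thesis .
qed

section \<open>Neighbourhoods, and the edges leaving a neighbour\<close>

definition nbrs :: "'a \<Rightarrow> 'a set" where
  "nbrs i = (\<Union>e\<in>edges_at i. e - {i})"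

lemma card_nbrs: "card (nbrs i) = (k - 1) * card (edges_at i)"
proof -
  have "card (nbrs i) = (\<Sum>e\<in>edges_at i. card (e - {i}))"
    unfolding nbrs_def
  proof (rule card_UN_disjoint)
    show "\<forall>e\<in>edges_at i. \<forall>f\<in>edges_at i. e \<noteq> f \<longrightarrow> (e - {i}) \<inter> (f - {i}) = {}"
      using edge_eqI by (auto simp: edges_at_def)
  qed (auto simp: finite_edges_at, auto simp: edges_at_def finite_edge)
  also have "\<dots> = (\<Sum>e\<in>edges_at i. k - 1)"
    by (intro sum.cong refl) (auto simp: edges_at_def card_edge)
  finally show ?thesis by simp
qed

lemma nbrs_sub: "nbrs i \<subseteq> verts H - {i}"
  using edge_sub by (auto simp: nbrs_def edges_at_def)

text \<open>The vertex \<open>u\<close> is removed before the test because, for \<open>u\<close> in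
  \<open>e - {i}\<close> with \<open>e\<close> an edge at \<open>i\<close>, it is itself a neighbour
  of \<open>i\<close>.\<close>

definition private_edges :: "'a \<Rightarrow> 'a set \<Rightarrow> 'a \<Rightarrow> 'a set set" where
  "private_edges i e u = {f \<in> edges_at u - {e}. (f - {u}) \<inter> nbrs i = {}}"

text \<open>Its cardinality counts the ways to reach \<open>w\<close> from \<open>i\<close> through
  \<open>e\<close> and then a private edge, since by linearity \<open>u\<close> and \<open>w\<close>
  determine that edge.\<close>

definition private_link :: "'a \<Rightarrow> 'a set \<Rightarrow> 'a \<Rightarrow> 'a set" where
  "private_link i e w = {u \<in> e - {i}. \<exists>f\<in>private_edges i e u. w \<in> f - {u}}"

text \<open>The summand 1 is \<open>e\<close> itself. Any other edge at \<open>u\<close> that is not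
  private contains a second neighbour of \<open>i\<close>; choosing one is injective, as edges at
  \<open>u\<close> meet only in \<open>u\<close>, and the chosen vertices are outer common
  neighbours of \<open>u\<close> and \<open>i\<close>.\<close>

lemma card_edges_at_le:
  assumes e: "e \<in> edges_at i" and u: "u \<in> e - {i}"
    and "s \<ge> 1" and book: "\<not> contains_Berge H (book_graph s)"
  shows "card (edges_at u) \<le> 1 + card (private_edges i e u) + (2 * k - 3) * (s - 1)"
proof -
  let ?M = "{f \<in> edges_at u - {e}. (f - {u}) \<inter> nbrs i \<noteq> {}}"
  have eE: "e \<in> edges H" "i \<in> e"
    using e by (auto simp: edges_at_def)
  have "\<forall>f\<in>?M. \<exists>w. w \<in> (f - {u}) \<inter> nbrs i" by blast
  then obtain c where "\<forall>f\<in>?M. c f \<in> (f - {u}) \<inter> nbrs i"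
    by (rule bchoice[THEN exE])
  then have c: "c f \<in> (f - {u}) \<inter> nbrs i" if "f \<in> ?M" for f
    using that by (rule bspec)
  have "card ?M \<le> card (outer_common_nbrs e u i)"
  proof (rule card_inj_on_le)
    show "inj_on c ?M"
    proof (rule inj_onI)
      fix f g assume fg: "f \<in> ?M" "g \<in> ?M" "c f = c g"
      then show "f = g"
        using edge_eqI[of f g u "c f"] c[OF fg(1)] c[OF fg(2)] by (auto simp: edges_at_def)
    qed
    show "c ` ?M \<subseteq> outer_common_nbrs e u i"
    proof (rule image_subsetI)
      fix f assume fM: "f \<in> ?M"
      then have f: "f \<in> edges_at u" "f \<noteq> e"
        by auto
      have cf: "c f \<in> f" "c f \<noteq> u" "c f \<in> nbrs i"
        using c[OF fM] by auto
      then obtain g where g: "g \<in> edges_at i" "c f \<in> g"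
        by (auto simp: nbrs_def)
      \<comment> \<open>Otherwise \<open>f\<close> and \<open>e\<close> would share \<open>u\<close>
        and \<open>c f\<close>. Hence the edge \<open>g\<close> joining \<open>i\<close> to
        \<open>c f\<close> is not \<open>e\<close>.\<close>
      have "c f \<notin> e"
        using edge_eqI[of e f u "c f"] cf f u eE by (auto simp: edges_at_def)
      with g f cf show "c f \<in> outer_common_nbrs e u i"
        by (auto simp: outer_common_nbrs_def)
    qed
  qed (rule finite_outer_common_nbrs)
  also have "\<dots> \<le> (2 * k - 3) * (s - 1)"
    using eE u assms by (intro card_outer_common_nbrs) auto
  finally have M: "card ?M \<le> (2 * k - 3) * (s - 1)" .
  have "edges_at u = insert e (private_edges i e u \<union> ?M)"
    using u eE by (auto simp: private_edges_def edges_at_def)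
  then have "card (edges_at u) = card (insert e (private_edges i e u \<union> ?M))"
    by (rule arg_cong)
  also have "\<dots> \<le> 1 + card (private_edges i e u \<union> ?M)"
    using finite_edges_at[of u] by (simp add: private_edges_def card_insert_if)
  also have "\<dots> \<le> 1 + (card (private_edges i e u) + card ?M)"
    by (intro add_left_mono card_Un_le)
  finally show ?thesis using M by simp
qed

section \<open>Counting the vertices not adjacent to the centre\<close>

definition far :: "'a \<Rightarrow> 'a set" where
  "far i = verts H - {i} - nbrs i"

lemma finite_far: "finite (far i)"
  using finite_verts by (simp add: far_def)

lemma card_far:
  assumes "i \<in> verts H"
  shows "card (far i) + (k - 1) * card (edges_at i) + 1 = card (verts H)"
proof -
  have "card (far i) + card (nbrs i) = card (verts H - {i})"
    using nbrs_sub[of i] finite_verts unfolding far_def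
    by (metis card_Diff_subset card_mono finite_Diff finite_subset le_add_diff_inverse2)
  then show ?thesis
    using assms finite_verts card_gt_0_iff[of "verts H"] by (auto simp: card_nbrs)
qed

text \<open>Since \<open>i\<close> is not in \<open>nbrs i\<close>, the definition of
  \<open>private_edges\<close> does not rule it out; linearity does, as \<open>f\<close> would share
  \<open>u\<close> and \<open>i\<close> with \<open>e\<close>.\<close>

lemma centre_notin_private:
  assumes "e \<in> edges_at i" "u \<in> e - {i}" "f \<in> private_edges i e u"
  shows "i \<notin> f"
  using assms edge_eqI[of e f u i] by (auto simp: edges_at_def private_edges_def)

text \<open>Private edges at \<open>u\<close> pairwise meet only in \<open>u\<close>, and each
  contributes \<open>k - 1\<close> further vertices, all of them far from \<open>i\<close>.\<close>

lemma card_private_edges: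
  assumes e: "e \<in> edges_at i" and u: "u \<in> e - {i}"
  shows "(k - 1) * card (private_edges i e u) \<le> card {w \<in> far i. u \<in> private_link i e w}"
proof -
  let ?P = "private_edges i e u"
  have P: "f \<in> edges H" "u \<in> f" if "f \<in> ?P" for f
    using that by (auto simp: private_edges_def edges_at_def)
  have "(\<Sum>f\<in>?P. card (f - {u})) = card (\<Union>f\<in>?P. f - {u})"
  proof (rule card_UN_disjoint[symmetric])
    show "finite ?P"
      using finite_edges_at by (simp add: private_edges_def)
    show "\<forall>f\<in>?P. finite (f - {u})"
      using P finite_edge by auto
    show "\<forall>f\<in>?P. \<forall>g\<in>?P. f \<noteq> g \<longrightarrow> (f - {u}) \<inter> (g - {u}) = {}"
      using P edge_eqI by blast
  qed
  moreover have "(\<Sum>f\<in>?P. card (f - {u})) = (\<Sum>f\<in>?P. k - 1)"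
    by (intro sum.cong refl) (use P card_edge in auto)
  moreover have "(\<Union>f\<in>?P. f - {u}) \<subseteq> {w \<in> far i. u \<in> private_link i e w}"
  proof (intro UN_least subsetI)
    fix f w assume f: "f \<in> ?P" and w: "w \<in> f - {u}"
    have "w \<in> far i"
      using edge_sub[OF P(1)[OF f]] centre_notin_private[OF e u f] f w
      by (auto simp: far_def private_edges_def)
    with f w u show "w \<in> {w \<in> far i. u \<in> private_link i e w}"
      by (auto simp: private_link_def)
  qed
  ultimately show ?thesis
    using card_mono[of "{w \<in> far i. u \<in> private_link i e w}"] finite_far by (simp add: mult.commute)
qed

text \<open>Each counted edge \<open>e\<close> yields a vertex \<open>c e\<close> joined to
  \<open>i\<close> by \<open>e\<close> and to \<open>w\<close> by a private edge \<open>g e\<close>.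
  With \<open>t\<close> such edges these form a Berge copy of \<open>K2_graph t\<close> whose part
  of size two is \<open>i\<close>, \<open>w\<close>.\<close>

lemma card_linked_edges:
  assumes "i \<in> verts H" and w: "w \<in> far i" and "t \<ge> 1"
    and K2: "\<not> contains_Berge H (K2_graph t)"
  shows "card {e \<in> edges_at i. private_link i e w \<noteq> {}} \<le> t - 1"
proof (rule ccontr)
  let ?T = "{e \<in> edges_at i. private_link i e w \<noteq> {}}"
  assume "\<not> ?thesis"
  then have tT: "t \<le> card ?T" by simp
  \<comment> \<open>The private edge depends on the chosen vertex, so both are chosen together as a
    pair.\<close>
  have "\<forall>e\<in>?T. \<exists>p. fst p \<in> e - {i} \<and> snd p \<in> private_edges i e (fst p) \<and> w \<in> snd p - {fst p}"
    by (auto simp: private_link_def)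
  then obtain p where
    "\<forall>e\<in>?T. fst (p e) \<in> e - {i} \<and> snd (p e) \<in> private_edges i e (fst (p e)) \<and> w \<in> snd (p e) - {fst (p e)}"
    by (rule bchoice[THEN exE])
  then obtain c g where
    cg: "\<forall>e\<in>?T. c e \<in> e - {i} \<and> g e \<in> private_edges i e (c e) \<and> w \<in> g e - {c e}"
    by (meson that[of "\<lambda>e. fst (p e)" "\<lambda>e. snd (p e)"])
  have c: "c e \<in> e - {i}" and gP: "g e \<in> private_edges i e (c e)" and wg: "w \<in> g e - {c e}"
    and eE: "e \<in> edges_at i" if "e \<in> ?T" for e
    using bspec[OF cg that] that by auto
  have g: "g e \<in> edges H" "c e \<in> g e" "(g e - {c e}) \<inter> nbrs i = {}" "i \<notin> g e" if "e \<in> ?T" for e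
    using gP[OF that] centre_notin_private[OF eE c gP, OF that that that]
    by (auto simp: private_edges_def edges_at_def)
  have "contains_Berge H (K2_graph t)"
  proof (rule contains_Berge_K2[where x = i and y = w and T = ?T and c = c and f = id and g = g])
    show "i \<noteq> w" "w \<in> verts H"
      using w by (auto simp: far_def)
    show "finite ?T"
      using finite_edges_at by simp
    show "inj_on c ?T"
    proof (rule inj_onI)
      fix e e' assume ee: "e \<in> ?T" "e' \<in> ?T" "c e = c e'"
      then show "e = e'"
        using edge_eqI[of e e' i "c e"] c[OF ee(1)] c[OF ee(2)] by (auto simp: edges_at_def)
    qed
    show "inj_on g ?T"
    proof (rule inj_onI)
      fix e e' assume ee: "e \<in> ?T" "e' \<in> ?T" "g e = g e'"
      \<comment> \<open>The only neighbour of \<open>i\<close> on the private edge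
        \<open>g e\<close> is \<open>c e\<close>, so equal private edges force equal
        vertices.\<close>
      have "c e' \<in> nbrs i"
        using c[OF ee(2)] ee(2) by (auto simp: nbrs_def)
      then have "c e = c e'"
        using g(2,3)[OF ee(1)] g(2)[OF ee(2)] ee(3) by auto
      with ee \<open>inj_on c ?T\<close> show "e = e'"
        by (simp only: inj_on_eq_iff)
    qed
    show "id e \<noteq> g e'" if "e \<in> ?T" "e' \<in> ?T" for e e'
      using g(4)[OF that(2)] eE[OF that(1)] by (auto simp: edges_at_def)
    show "c e \<noteq> i \<and> c e \<noteq> w" if "e \<in> ?T" for e
      using c[OF that] wg[OF that] by auto
    show "id e \<in> edges H \<and> g e \<in> edges H" if "e \<in> ?T" for e
      using g[OF that] eE[OF that] by (auto simp: edges_at_def)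
    show "i \<in> id e \<and> c e \<in> id e \<and> w \<in> g e \<and> c e \<in> g e" if "e \<in> ?T" for e
      using g[OF that] eE[OF that] c[OF that] wg[OF that] by (auto simp: edges_at_def)
  qed (use assms tT edge_sub in auto)
  with K2 show False by simp
qed

text \<open>Double counting over the \<open>(k - 1) * (k - 2)\<close> ordered pairs of distinct
  vertices of \<open>e - {i}\<close>: a \<open>w\<close> linked to both members of a pair is one of
  their outer common neighbours.\<close>

lemma sum_private_link_pairs:
  assumes e: "e \<in> edges_at i"
    and "s \<ge> 1" and book: "\<not> contains_Berge H (book_graph s)"
  shows "(\<Sum>w\<in>far i. card (private_link i e w) * (card (private_link i e w) - 1))
           \<le> (k - 1) * (k - 2) * ((2 * k - 3) * (s - 1))"
proof -
  let ?L = "private_link i e" and ?A = "e - {i}"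
  have finA: "finite ?A" and cardA: "card ?A = k - 1" and eE: "e \<in> edges H"
    using e finite_edge card_edge by (auto simp: edges_at_def)
  have L: "?L w \<subseteq> ?A" for w
    by (auto simp: private_link_def)
  have "(\<Sum>w\<in>far i. card (?L w) * (card (?L w) - 1))
      = (\<Sum>w\<in>far i. card {q \<in> (SIGMA u:?A. ?A - {u}). fst q \<in> ?L w \<and> snd q \<in> ?L w})"
  proof (intro sum.cong refl)
    fix w
    have "finite (?L w)"
      using L finA finite_subset by blast
    then have "card (?L w) * (card (?L w) - 1) = card (SIGMA u:?L w. ?L w - {u})"
      by (rule card_off_diagonal[symmetric])
    also have "(SIGMA u:?L w. ?L w - {u}) = {q \<in> (SIGMA u:?A. ?A - {u}). fst q \<in> ?L w \<and> snd q \<in> ?L w}"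
      using L[of w] by auto
    finally show "card (?L w) * (card (?L w) - 1)
        = card {q \<in> (SIGMA u:?A. ?A - {u}). fst q \<in> ?L w \<and> snd q \<in> ?L w}" .
  qed
  also have "\<dots> = (\<Sum>q\<in>(SIGMA u:?A. ?A - {u}). card {w \<in> far i. fst q \<in> ?L w \<and> snd q \<in> ?L w})"
    using finA by (intro sum_card_Collect_swap finite_far) auto
  also have "\<dots> \<le> (\<Sum>q\<in>(SIGMA u:?A. ?A - {u}). (2 * k - 3) * (s - 1))"
  proof (rule sum_mono)
    fix q assume "q \<in> (SIGMA u:?A. ?A - {u})"
    then obtain u v where q: "q = (u, v)" "u \<in> e" "v \<in> e" "u \<noteq> v"
      by auto
    have "{w \<in> far i. fst q \<in> ?L w \<and> snd q \<in> ?L w} \<subseteq> outer_common_nbrs e u v"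
      by (auto simp: q(1) outer_common_nbrs_def private_link_def private_edges_def)
    then have "card {w \<in> far i. fst q \<in> ?L w \<and> snd q \<in> ?L w} \<le> card (outer_common_nbrs e u v)"
      by (intro card_mono finite_outer_common_nbrs)
    also have "\<dots> \<le> (2 * k - 3) * (s - 1)"
      using eE q assms by (intro card_outer_common_nbrs)
    finally show "card {w \<in> far i. fst q \<in> ?L w \<and> snd q \<in> ?L w} \<le> (2 * k - 3) * (s - 1)" .
  qed
  also have "\<dots> = card ?A * (card ?A - 1) * ((2 * k - 3) * (s - 1))"
    using card_off_diagonal[OF finA] by simp
  also have "card ?A * (card ?A - 1) = (k - 1) * (k - 2)"
    unfolding cardA by (simp add: numeral_2_eq_2)
  finally show ?thesis .
qed

text \<open>Counting through the links, a link of size \<open>a\<close> is charged once if nonempty,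
  which \<open>card_linked_edges\<close> controls, and once per unordered pair in it, which
  \<open>sum_private_link_pairs\<close> controls. The factor 2 allows ordered pairs.\<close>

lemma sum_private_edges:
  assumes i: "i \<in> verts H" and "s \<ge> 1" "t \<ge> 1"
    and book: "\<not> contains_Berge H (book_graph s)" and K2: "\<not> contains_Berge H (K2_graph t)"
  shows "2 * (k - 1) * (\<Sum>e\<in>edges_at i. \<Sum>u\<in>e - {i}. card (private_edges i e u))
           \<le> 2 * (t - 1) * card (far i) + card (edges_at i) * ((k - 1) * (k - 2) * ((2 * k - 3) * (s - 1)))"
proof -
  let ?L = "private_link i"
  have "(k - 1) * (\<Sum>e\<in>edges_at i. \<Sum>u\<in>e - {i}. card (private_edges i e u))
      \<le> (\<Sum>e\<in>edges_at i. \<Sum>u\<in>e - {i}. card {w \<in> far i. u \<in> ?L e w})"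
    unfolding sum_distrib_left by (intro sum_mono card_private_edges)
  also have "\<dots> = (\<Sum>e\<in>edges_at i. \<Sum>w\<in>far i. card (?L e w))"
  proof (rule sum.cong[OF refl])
    fix e assume "e \<in> edges_at i"
    then have "finite (e - {i})"
      using finite_edge by (auto simp: edges_at_def)
    moreover have "{u \<in> e - {i}. u \<in> ?L e w} = ?L e w" for w
      by (auto simp: private_link_def)
    ultimately show "(\<Sum>u\<in>e - {i}. card {w \<in> far i. u \<in> ?L e w}) = (\<Sum>w\<in>far i. card (?L e w))"
      using sum_card_Collect_swap[OF _ finite_far, of "e - {i}" i "\<lambda>u w. u \<in> ?L e w"] by simp
  qed
  finally have "2 * (k - 1) * (\<Sum>e\<in>edges_at i. \<Sum>u\<in>e - {i}. card (private_edges i e u))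
      \<le> (\<Sum>e\<in>edges_at i. \<Sum>w\<in>far i. 2 * card (?L e w))"
    by (simp flip: sum_distrib_left)
  also have "\<dots> \<le> (\<Sum>e\<in>edges_at i. \<Sum>w\<in>far i.
      2 * (if ?L e w \<noteq> {} then 1 else 0) + card (?L e w) * (card (?L e w) - 1))"
  proof (intro sum_mono)
    fix e w
    \<comment> \<open>Over the integers this is \<open>(a - 1) * (a - 2) \<ge> 0\<close>, with
      equality at 1 and 2.\<close>
    have "2 * a \<le> 2 + a * (a - 1)" for a :: nat
    proof (cases "a \<le> 2")
      case True
      then have "a = 0 \<or> a = 1 \<or> a = 2" by auto
      then show ?thesis by auto
    next
      case False
      then have "a * 2 \<le> a * (a - 1)"
        by (intro mult_le_mono) auto
      then show ?thesis by linarith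
    qed
    from this[of "card (?L e w)"]
    show "2 * card (?L e w) \<le> 2 * (if ?L e w \<noteq> {} then 1 else 0) + card (?L e w) * (card (?L e w) - 1)"
      by auto
  qed
  also have "\<dots> = 2 * (\<Sum>w\<in>far i. card {e \<in> edges_at i. ?L e w \<noteq> {}})
      + (\<Sum>e\<in>edges_at i. \<Sum>w\<in>far i. card (?L e w) * (card (?L e w) - 1))"
  proof -
    have "(\<Sum>e\<in>edges_at i. \<Sum>w\<in>far i. if ?L e w \<noteq> {} then 1 else 0)
        = (\<Sum>w\<in>far i. card {e \<in> edges_at i. ?L e w \<noteq> {}})"
      by (subst sum.swap) (simp add: finite_edges_at sum.If_cases Int_def)
    then show ?thesis
      by (simp only: sum.distrib sum_distrib_left[symmetric])
  qed
  also have "\<dots> \<le> 2 * (\<Sum>w\<in>far i. t - 1)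
      + (\<Sum>e\<in>edges_at i. (k - 1) * (k - 2) * ((2 * k - 3) * (s - 1)))"
    by (intro add_mono mult_left_mono sum_mono card_linked_edges sum_private_link_pairs assms) auto
  finally show ?thesis
    by (simp add: mult_ac)
qed

text \<open>Sum \<open>card_edges_at_le\<close> over the neighbours, \<open>k - 1\<close> on each
  edge at \<open>i\<close>, and insert \<open>sum_private_edges\<close>. The factor
  \<open>2 * (k - 1)\<close> keeps the estimate free of division.\<close>

lemma sum_nbr_degrees:
  assumes i: "i \<in> verts H" and "s \<ge> 1" "t \<ge> 1"
    and book: "\<not> contains_Berge H (book_graph s)" and K2: "\<not> contains_Berge H (K2_graph t)"
  shows "2 * (k - 1) * (\<Sum>e\<in>edges_at i. \<Sum>u\<in>e - {i}. card (edges_at u))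
           \<le> 2 * (k - 1) * (card (edges_at i) * ((k - 1) * (1 + (2 * k - 3) * (s - 1))))
             + 2 * (t - 1) * card (far i) + card (edges_at i) * ((k - 1) * (k - 2) * ((2 * k - 3) * (s - 1)))"
proof -
  let ?c = "(2 * k - 3) * (s - 1)"
  have "(\<Sum>e\<in>edges_at i. \<Sum>u\<in>e - {i}. card (edges_at u))
      \<le> (\<Sum>e\<in>edges_at i. \<Sum>u\<in>e - {i}. (1 + ?c) + card (private_edges i e u))"
    using card_edges_at_le[OF _ _ \<open>s \<ge> 1\<close> book] by (intro sum_mono) (auto simp: algebra_simps)
  also have "\<dots> = (\<Sum>e\<in>edges_at i. (k - 1) * (1 + ?c)) + (\<Sum>e\<in>edges_at i. \<Sum>u\<in>e - {i}. card (private_edges i e u))"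
  proof -
    have "(\<Sum>u\<in>e - {i}. (1 + ?c) + card (private_edges i e u))
        = (k - 1) * (1 + ?c) + (\<Sum>u\<in>e - {i}. card (private_edges i e u))" if "e \<in> edges_at i" for e
      using that unfolding sum.distrib[of "\<lambda>_. 1 + ?c"] by (simp add: edges_at_def card_edge)
    then show ?thesis
      by (simp only: sum.distrib cong: sum.cong)
  qed
  finally have "2 * (k - 1) * (\<Sum>e\<in>edges_at i. \<Sum>u\<in>e - {i}. card (edges_at u))
      \<le> 2 * (k - 1) * (card (edges_at i) * ((k - 1) * (1 + ?c)))
        + 2 * (k - 1) * (\<Sum>e\<in>edges_at i. \<Sum>u\<in>e - {i}. card (private_edges i e u))"
    unfolding add_mult_distrib2[symmetric] by (intro mult_le_mono2) simp
  with sum_private_edges[OF assms] show ?thesis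
    by linarith
qed

subsection \<open>Eigenvalues\<close>

lemma max_degree_ge: "i \<in> verts H \<Longrightarrow> card (edges_at i) \<le> max_degree H"
  using finite_verts by (simp add: max_degree_def flip: vertex_degree_eq)

text \<open>Together with \<open>i\<close>, the \<open>k - 1\<close> entries must fill an edge of
  size \<open>k\<close>, so they are distinct and avoid \<open>i\<close>.\<close>

lemma lists_adjacent_eq:
  assumes i: "i \<in> verts H"
  shows "{js. set js \<subseteq> verts H \<and> length js = k - 1 \<and> insert i (set js) \<in> edges H}
           = (\<Union>e\<in>edges_at i. permutations_of_set (e - {i}))"
proof (intro equalityI subsetI)
  fix js assume "js \<in> {js. set js \<subseteq> verts H \<and> length js = k - 1 \<and> insert i (set js) \<in> edges H}"
  then have js: "length js = k - 1" "insert i (set js) \<in> edges H" by auto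
  have "card (insert i (set js)) = k"
    using js card_edge by blast
  moreover have "card (set js) \<le> k - 1"
    using card_length[of js] js by simp
  ultimately have "i \<notin> set js" "card (set js) = length js"
    using js k3 by (auto simp: card_insert_if split: if_splits)
  then have "js \<in> permutations_of_set (insert i (set js) - {i})"
    by (auto simp: permutations_of_set_def card_distinct)
  with js show "js \<in> (\<Union>e\<in>edges_at i. permutations_of_set (e - {i}))"
    by (auto simp: edges_at_def)
next
  fix js assume "js \<in> (\<Union>e\<in>edges_at i. permutations_of_set (e - {i}))"
  then obtain e where e: "e \<in> edges H" "i \<in> e" "set js = e - {i}" "distinct js"
    by (auto simp: edges_at_def permutations_of_set_def)
  then have "length js = k - 1" "insert i (set js) = e"
    using card_edge[OF e(1)] distinct_card[OF e(4)] by auto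
  with e edge_sub[OF e(1)] show "js \<in> {js. set js \<subseteq> verts H \<and> length js = k - 1 \<and> insert i (set js) \<in> edges H}"
    by auto
qed

text \<open>The \<open>(k - 1)!\<close> orderings of \<open>e - {i}\<close> cancel the normalisation
  of the adjacency tensor; the degree tensor sees only the constant list.\<close>

lemma alpha_tensor_apply:
  fixes x :: "'a \<Rightarrow> complex"
  assumes i: "i \<in> verts H"
  shows "(\<Sum>js\<in>{js. set js \<subseteq> verts H \<and> length js = k - 1}. alpha_tensor k \<alpha> H (i # js) * prod_list (map x js))
     = of_real \<alpha> * of_nat (card (edges_at i)) * x i ^ (k - 1)
       + of_real (1 - \<alpha>) * (\<Sum>e\<in>edges_at i. \<Prod>j\<in>e - {i}. x j)"
proof -
  let ?L = "{js. set js \<subseteq> verts H \<and> length js = k - 1}"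
  have finL: "finite ?L"
    using finite_verts by (rule finite_lists_length_eq)
  have kS: "k = Suc (k - 1)" using k3 by simp
  have "(\<Sum>js\<in>?L. degree_tensor k H (i # js) * prod_list (map x js))
      = (\<Sum>js\<in>?L. if js = replicate (k - 1) i then of_nat (card (edges_at i)) * x i ^ (k - 1) else 0)"
  proof (intro sum.cong refl)
    fix js
    have "i # js = replicate k i \<longleftrightarrow> js = replicate (k - 1) i"
      by (subst kS) simp
    then show "degree_tensor k H (i # js) * prod_list (map x js)
        = (if js = replicate (k - 1) i then of_nat (card (edges_at i)) * x i ^ (k - 1) else 0)"
      by (auto simp: degree_tensor_def vertex_degree_eq)
  qed
  also have "\<dots> = of_nat (card (edges_at i)) * x i ^ (k - 1)"
    using i by (subst sum.delta[OF finL]) auto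
  finally have deg: "(\<Sum>js\<in>?L. degree_tensor k H (i # js) * prod_list (map x js))
      = of_nat (card (edges_at i)) * x i ^ (k - 1)" .
  have "(\<Sum>js\<in>?L. adjacency_tensor k H (i # js) * prod_list (map x js))
      = (\<Sum>js\<in>?L. if insert i (set js) \<in> edges H then prod_list (map x js) / fact (k - 1) else 0)"
    using k3 by (intro sum.cong refl) (auto simp: adjacency_tensor_def)
  also have "\<dots> = (\<Sum>js\<in>{js\<in>?L. insert i (set js) \<in> edges H}. prod_list (map x js) / fact (k - 1))"
    using finL by (rule sum.inter_filter[symmetric])
  also have "{js\<in>?L. insert i (set js) \<in> edges H} = (\<Union>e\<in>edges_at i. permutations_of_set (e - {i}))"
    using lists_adjacent_eq[OF i] by (simp add: conj_assoc)
  also have "(\<Sum>js\<in>\<dots>. prod_list (map x js) / fact (k - 1))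
      = (\<Sum>e\<in>edges_at i. \<Sum>js\<in>permutations_of_set (e - {i}). prod_list (map x js) / fact (k - 1))"
  proof (rule sum.UNION_disjoint)
    show "\<forall>e\<in>edges_at i. \<forall>f\<in>edges_at i. e \<noteq> f \<longrightarrow>
        permutations_of_set (e - {i}) \<inter> permutations_of_set (f - {i}) = {}"
      by (auto simp: edges_at_def permutations_of_set_def)
  qed (auto simp: finite_edges_at)
  also have "\<dots> = (\<Sum>e\<in>edges_at i. \<Prod>j\<in>e - {i}. x j)"
  proof (intro sum.cong refl)
    fix e assume "e \<in> edges_at i"
    then have e: "finite (e - {i})" "card (e - {i}) = k - 1"
      using finite_edge card_edge by (auto simp: edges_at_def)
    have "(\<Sum>js\<in>permutations_of_set (e - {i}). prod_list (map x js) / fact (k - 1))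
        = (\<Sum>js\<in>permutations_of_set (e - {i}). (\<Prod>j\<in>e - {i}. x j) / fact (k - 1))"
      by (intro sum.cong refl) (auto simp: permutations_of_set_def simp flip: prod.distinct_set_conv_list)
    also have "\<dots> = (\<Prod>j\<in>e - {i}. x j)"
      using e by simp
    finally show "(\<Sum>js\<in>permutations_of_set (e - {i}). prod_list (map x js) / fact (k - 1)) = (\<Prod>j\<in>e - {i}. x j)" .
  qed
  finally have adj: "(\<Sum>js\<in>?L. adjacency_tensor k H (i # js) * prod_list (map x js))
      = (\<Sum>e\<in>edges_at i. \<Prod>j\<in>e - {i}. x j)" .
  show ?thesis
    unfolding mult.assoc deg[symmetric] adj[symmetric]
    by (simp only: alpha_tensor_def distrib_right sum.distrib sum_distrib_left mult.assoc)
qed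

text \<open>
  Since edges have at least three vertices, the adjacency part vanishes on unit vectors,
  so these are eigenvectors.
\<close>

lemma ex_alpha_eigenvalue:
  assumes v: "v \<in> verts H"
  shows "tensor_eigenvalue k (verts H) (alpha_tensor k \<alpha> H) (of_real \<alpha> * of_nat (card (edges_at v)))"
  unfolding tensor_eigenvalue_def
proof (intro exI conjI ballI)
  let ?x = "\<lambda>j. if j = v then 1 else 0 :: complex"
  show "\<exists>v\<in>verts H. ?x v \<noteq> 0"
    using v by auto
  fix i assume i: "i \<in> verts H"
  have "(\<Prod>j\<in>e - {i}. ?x j) = 0" if "e \<in> edges_at i" for e
  proof (rule prod_zero)
    have "card (e - {i}) = k - 1" and fin: "finite e"
      using that finite_edge card_edge by (auto simp: edges_at_def)
    then have "\<not> e - {i} \<subseteq> {v}"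
      using k3 card_mono[of "{v}" "e - {i}"] by auto
    then show "\<exists>j\<in>e - {i}. ?x j = 0" by auto
    show "finite (e - {i})" using fin by simp
  qed
  then show "(\<Sum>js\<in>{js. set js \<subseteq> verts H \<and> length js = k - 1}. alpha_tensor k \<alpha> H (i # js) * prod_list (map ?x js))
      = of_real \<alpha> * of_nat (card (edges_at v)) * ?x i ^ (k - 1)"
    unfolding alpha_tensor_apply[OF i] using k3 by simp
qed

text \<open>Take \<open>i\<close> where the modulus of the eigenvector is largest. Multiplying the
  estimate at \<open>i\<close> by \<open>cmod \<mu>\<close> allows a second use of the eigenvalue
  equation, at the neighbours of \<open>i\<close>, which brings in their degrees.\<close>

lemma alpha_eigenvalue_bound:
  assumes \<alpha>: "0 \<le> \<alpha>" "\<alpha> < 1" and eig: "tensor_eigenvalue k (verts H) (alpha_tensor k \<alpha> H) \<mu>"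
  obtains i where "i \<in> verts H"
    "cmod \<mu> ^ 2 \<le> \<alpha> * real (card (edges_at i)) ^ 2
       + (1 - \<alpha>) * (real (\<Sum>e\<in>edges_at i. \<Sum>u\<in>e - {i}. card (edges_at u)) / real (k - 1))"
proof -
  obtain x v where v: "v \<in> verts H" "x v \<noteq> 0"
    and x: "\<And>j. j \<in> verts H \<Longrightarrow>
      of_real \<alpha> * of_nat (card (edges_at j)) * x j ^ (k - 1)
       + of_real (1 - \<alpha>) * (\<Sum>e\<in>edges_at j. \<Prod>l\<in>e - {j}. x l) = \<mu> * x j ^ (k - 1)"
  proof -
    from eig obtain x v where v: "v \<in> verts H" "x v \<noteq> 0"
      and x: "\<And>j. j \<in> verts H \<Longrightarrow>
        (\<Sum>js\<in>{js. set js \<subseteq> verts H \<and> length js = k - 1}. alpha_tensor k \<alpha> H (j # js) * prod_list (map x js))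
          = \<mu> * x j ^ (k - 1)"
      unfolding tensor_eigenvalue_def by blast
    have "of_real \<alpha> * of_nat (card (edges_at j)) * x j ^ (k - 1)
        + of_real (1 - \<alpha>) * (\<Sum>e\<in>edges_at j. \<Prod>l\<in>e - {j}. x l) = \<mu> * x j ^ (k - 1)"
      if "j \<in> verts H" for j
      using x[OF that] unfolding alpha_tensor_apply[OF that] .
    with v show thesis
      by (rule that)
  qed
  define a where "a j = cmod (x j)" for j
  define m where "m = Max (a ` verts H)"
  have "m \<in> a ` verts H"
    unfolding m_def using finite_verts v by (intro Max_in) auto
  then obtain i where i: "i \<in> verts H" "a i = m" by auto
  have le_m: "a j \<le> m" if "j \<in> verts H" for j
    unfolding m_def using finite_verts that by (intro Max_ge) auto
  have a0: "a j \<ge> 0" for j by (simp add: a_def)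
  have "a v > 0" using v by (simp add: a_def)
  with le_m[OF v(1)] have m: "m > 0" by simp
  define M where "M = m ^ (k - 1)"
  have M: "M > 0" using m by (simp add: M_def)
  have norm_le: "cmod \<mu> * a j ^ (k - 1) \<le> \<alpha> * card (edges_at j) * a j ^ (k - 1)
      + (1 - \<alpha>) * (\<Sum>e\<in>edges_at j. \<Prod>l\<in>e - {j}. a l)" if "j \<in> verts H" for j
  proof -
    have "cmod \<mu> * a j ^ (k - 1) = cmod (\<mu> * x j ^ (k - 1))"
      by (simp add: a_def norm_mult norm_power)
    also have "\<dots> \<le> cmod (of_real \<alpha> * of_nat (card (edges_at j)) * x j ^ (k - 1))
        + cmod (of_real (1 - \<alpha>) * (\<Sum>e\<in>edges_at j. \<Prod>l\<in>e - {j}. x l))"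
      unfolding x[OF that, symmetric] by (rule norm_triangle_ineq)
    also have "cmod (of_real \<alpha> * of_nat (card (edges_at j)) * x j ^ (k - 1)) = \<alpha> * card (edges_at j) * a j ^ (k - 1)"
      using \<alpha> by (simp add: a_def norm_mult norm_power)
    also have "cmod (of_real (1 - \<alpha>) * (\<Sum>e\<in>edges_at j. \<Prod>l\<in>e - {j}. x l))
        = (1 - \<alpha>) * cmod (\<Sum>e\<in>edges_at j. \<Prod>l\<in>e - {j}. x l)"
      using \<alpha> by (simp add: norm_mult del: of_real_diff)
    also have "cmod (\<Sum>e\<in>edges_at j. \<Prod>l\<in>e - {j}. x l) \<le> (\<Sum>e\<in>edges_at j. \<Prod>l\<in>e - {j}. a l)"
      unfolding a_def prod_norm by (rule norm_sum)
    finally show ?thesis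
      using \<alpha> by (simp add: mult_left_mono)
  qed
  have edge: "card (e - {j}) = k - 1" "finite (e - {j})" "e - {j} \<noteq> {}" "e - {j} \<subseteq> verts H"
    if "e \<in> edges_at j" for e j
  proof -
    show c: "card (e - {j}) = k - 1" "finite (e - {j})" "e - {j} \<subseteq> verts H"
      using that finite_edge card_edge edge_sub by (auto simp: edges_at_def)
    show "e - {j} \<noteq> {}" using c(1) k3 by (intro notI) simp
  qed
  \<comment> \<open>All entries are bounded by the maximum \<open>m\<close>; the weights \<alpha>
    and \<open>1 - \<alpha>\<close> then add up to the degree.\<close>
  have le_deg: "cmod \<mu> * a j ^ (k - 1) \<le> card (edges_at j) * M" if j: "j \<in> verts H" for j
  proof -
    have "(\<Prod>l\<in>e - {j}. a l) \<le> M" if e: "e \<in> edges_at j" for e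
    proof -
      have "(\<Prod>l\<in>e - {j}. a l) \<le> (\<Prod>l\<in>e - {j}. m)"
        using edge(4)[OF e] a0 le_m by (intro prod_mono) auto
      then show ?thesis using edge(1)[OF e] by (simp add: M_def)
    qed
    then have "(\<Sum>e\<in>edges_at j. \<Prod>l\<in>e - {j}. a l) \<le> (\<Sum>e\<in>edges_at j. M)"
      by (rule sum_mono)
    then have "(1 - \<alpha>) * (\<Sum>e\<in>edges_at j. \<Prod>l\<in>e - {j}. a l) \<le> (1 - \<alpha>) * (card (edges_at j) * M)"
      using \<alpha> by (intro mult_left_mono) auto
    moreover have "a j ^ (k - 1) \<le> M"
      unfolding M_def using a0 le_m j by (intro power_mono) auto
    then have "\<alpha> * card (edges_at j) * a j ^ (k - 1) \<le> \<alpha> * card (edges_at j) * M"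
      using \<alpha> by (intro mult_left_mono) auto
    ultimately show ?thesis
      using norm_le[OF j] by (simp add: algebra_simps)
  qed
  \<comment> \<open>Because \<open>e - {i}\<close> has \<open>k - 1\<close> elements, AM-GM produces
    exactly the powers that \<open>le_deg\<close> bounds.\<close>
  have amgm: "cmod \<mu> * (\<Prod>l\<in>e - {i}. a l) \<le> M * (\<Sum>l\<in>e - {i}. card (edges_at l)) / (k - 1)"
    if e: "e \<in> edges_at i" for e
  proof -
    have "cmod \<mu> * (\<Prod>l\<in>e - {i}. a l) \<le> cmod \<mu> * ((\<Sum>l\<in>e - {i}. a l ^ (k - 1)) / (k - 1))"
      using prod_le_mean_power[OF edge(2,3)[OF e] a0] edge(1)[OF e] by (intro mult_left_mono) auto
    also have "\<dots> = (\<Sum>l\<in>e - {i}. cmod \<mu> * a l ^ (k - 1)) / (k - 1)"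
      by (simp add: sum_distrib_left)
    also have "\<dots> \<le> (\<Sum>l\<in>e - {i}. card (edges_at l) * M) / (k - 1)"
      using edge(4)[OF e] le_deg by (intro divide_right_mono sum_mono) auto
    also have "\<dots> = M * (\<Sum>l\<in>e - {i}. card (edges_at l)) / (k - 1)"
      by (simp add: sum_distrib_left mult.commute)
    finally show ?thesis .
  qed
  have "cmod \<mu> ^ 2 * M = cmod \<mu> * (cmod \<mu> * a i ^ (k - 1))"
    by (simp add: i M_def power2_eq_square)
  also have "\<dots> \<le> cmod \<mu> * (\<alpha> * card (edges_at i) * a i ^ (k - 1)
      + (1 - \<alpha>) * (\<Sum>e\<in>edges_at i. \<Prod>l\<in>e - {i}. a l))"
    by (intro mult_left_mono norm_le i) auto
  also have "\<dots> = \<alpha> * card (edges_at i) * (cmod \<mu> * a i ^ (k - 1))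
      + (1 - \<alpha>) * (\<Sum>e\<in>edges_at i. cmod \<mu> * (\<Prod>l\<in>e - {i}. a l))"
    by (simp add: algebra_simps sum_distrib_left)
  also have "\<dots> \<le> \<alpha> * card (edges_at i) * (card (edges_at i) * M)
      + (1 - \<alpha>) * (\<Sum>e\<in>edges_at i. M * (\<Sum>l\<in>e - {i}. card (edges_at l)) / (k - 1))"
    using \<alpha> by (intro add_mono mult_left_mono sum_mono amgm le_deg i) auto
  also have "\<dots> = (\<alpha> * real (card (edges_at i)) ^ 2
       + (1 - \<alpha>) * (real (\<Sum>e\<in>edges_at i. \<Sum>u\<in>e - {i}. card (edges_at u)) / real (k - 1))) * M"
    by (simp add: power2_eq_square algebra_simps sum_distrib_left sum_divide_distrib)
  finally show thesis
    using that[OF i(1)] M by simp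
qed

end

section \<open>From the degree count around one vertex to the spectral bound\<close>

theorem theorem4p2:
  fixes H :: "'a hypergraph" and n k s t \<Delta> :: nat and \<alpha> :: real
  assumes "n \<ge> 3" and "k \<ge> 3" and "s \<ge> 2" and "1 \<le> t"
    and "real t \<le> 1/2 * (6 * real k ^ 2 - 15 * real k + 10) * (real s - 1) + 1"
    and "0 \<le> \<alpha>" and "\<alpha> < 1"
    and "uniform_hypergraph k H" and "linear_hypergraph H" and "connected_hypergraph H"
    and "card (verts H) = n" and "max_degree H = \<Delta>"
    and "\<not> contains_Berge H (book_graph s)"
    and "\<not> contains_Berge H (K2_graph t)"
  shows "alpha_spectral_radius k \<alpha> H ^ 2 \<le>
           \<alpha> * real \<Delta> ^ 2 + (1 - \<alpha>) *
             ((real t - 1) * (real n - 1) / (real k - 1) ^ 2 +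
              ((6 * real k ^ 2 - 15 * real k + 10) * (real s - 1) - 2 * (real t - 1))
                / (2 * (real k - 1)) * real \<Delta>)"
proof -
  interpret linear_kgraph H k
    using assms by unfold_locales
  obtain v where "v \<in> verts H"
    using assms(10) by (auto simp: connected_hypergraph_def)
  \<comment> \<open>An eigenvalue exists, so the supremum is attained and bounding a single
    eigenvalue suffices.\<close>
  from tensor_spectral_radius_attained(1)[OF finite_verts ex_alpha_eigenvalue[OF this]]
  obtain \<mu> where "tensor_eigenvalue k (verts H) (alpha_tensor k \<alpha> H) \<mu>"
    and \<mu>: "cmod \<mu> = alpha_spectral_radius k \<alpha> H"
    unfolding alpha_spectral_radius_def by blast
  then obtain i where i: "i \<in> verts H" and le:
    "cmod \<mu> ^ 2 \<le> \<alpha> * real (card (edges_at i)) ^ 2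
       + (1 - \<alpha>) * (real (\<Sum>e\<in>edges_at i. \<Sum>u\<in>e - {i}. card (edges_at u)) / real (k - 1))"
    using alpha_eigenvalue_bound assms(6,7) by blast
  define S D where "S = real (\<Sum>e\<in>edges_at i. \<Sum>u\<in>e - {i}. card (edges_at u))"
    and "D = real (card (edges_at i))"
  define K \<sigma> where "K = real k - 1" and "\<sigma> = real s - 1"
  define P where "P = 6 * real k ^ 2 - 15 * real k + 10"
  have D: "0 \<le> D" "D \<le> real \<Delta>"
    using max_degree_ge[OF i] assms(12) by (auto simp: D_def)
  have K: "K \<ge> 2" "real (k - 1) = K" "real (k - 2) = K - 1" "real (2 * k - 3) = 2 * K - 1" "real k = K + 1"
    using \<open>k \<ge> 3\<close> by (auto simp: K_def of_nat_diff)
  have st: "real (s - 1) = \<sigma>" "\<sigma> \<ge> 1" "real (t - 1) = real t - 1"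
    using \<open>s \<ge> 2\<close> \<open>1 \<le> t\<close> by (auto simp: \<sigma>_def of_nat_diff)
  have P: "P = 3 * K * (2 * K - 1) + 1"
    by (simp add: P_def K(5) power2_eq_square algebra_simps)
  have "real (card (far i)) + K * D + 1 = real n"
    using arg_cong[OF card_far[OF i], of real] assms(11) unfolding of_nat_add of_nat_mult K(2) D_def by simp
  then have far: "real (card (far i)) = real n - 1 - K * D" by simp
  have "1 \<le> s" using \<open>s \<ge> 2\<close> by simp
  have "2 * K * S \<le> 2 * K * (D * (K * (1 + (2 * K - 1) * \<sigma>)))
      + 2 * (real t - 1) * (real n - 1 - K * D) + D * (K * (K - 1) * ((2 * K - 1) * \<sigma>))"
    using of_nat_mono[where 'a = real, OF sum_nbr_degrees[OF i \<open>1 \<le> s\<close> assms(4,13,14)]]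
    unfolding of_nat_add of_nat_mult K st far of_nat_1 of_nat_numeral S_def[symmetric] D_def[symmetric] .
  \<comment> \<open>The count gives \<open>D\<close> the coefficient
    \<open>K * (2 * K - 1) * (3 * K - 1) * \<sigma> + 2 * K ^ 2\<close>, apart from the
    \<open>t\<close> term coming from the far vertices. This falls short of
    \<open>K * P * \<sigma>\<close> by \<open>2 * K ^ 2 * (\<sigma> - 1)\<close>, which is
    nonnegative because \<open>s \<ge> 2\<close>.\<close>
  also have "\<dots> = 2 * (real t - 1) * (real n - 1) + K * (P * \<sigma> - 2 * (real t - 1)) * D - 2 * K * K * D * (\<sigma> - 1)"
    by (simp add: P algebra_simps)
  also have "\<dots> \<le> 2 * (real t - 1) * (real n - 1) + K * (P * \<sigma> - 2 * (real t - 1)) * D"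
    using K D st by simp
  \<comment> \<open>Passing from \<open>D\<close> to the maximum degree requires a nonnegative
    coefficient; this is the upper bound assumed on \<open>t\<close>.\<close>
  also have "\<dots> \<le> 2 * (real t - 1) * (real n - 1) + K * (P * \<sigma> - 2 * (real t - 1)) * real \<Delta>"
    using K D assms(5) by (intro add_left_mono mult_left_mono mult_nonneg_nonneg) (auto simp: P_def \<sigma>_def)
  finally have "2 * K * S / (2 * K ^ 2)
      \<le> (2 * (real t - 1) * (real n - 1) + K * (P * \<sigma> - 2 * (real t - 1)) * real \<Delta>) / (2 * K ^ 2)"
    by (rule divide_right_mono) simp
  then have "S / K \<le> (real t - 1) * (real n - 1) / K ^ 2 + (P * \<sigma> - 2 * (real t - 1)) / (2 * K) * real \<Delta>"
    using K(1) by (simp add: add_divide_distrib power2_eq_square mult.assoc del: right_diff_distrib_numeral)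
  then have "(1 - \<alpha>) * (S / K) \<le> (1 - \<alpha>) *
      ((real t - 1) * (real n - 1) / K ^ 2 + (P * \<sigma> - 2 * (real t - 1)) / (2 * K) * real \<Delta>)"
    using \<open>\<alpha> < 1\<close> by (intro mult_left_mono) auto
  moreover have "\<alpha> * D ^ 2 \<le> \<alpha> * real \<Delta> ^ 2"
    using D \<open>0 \<le> \<alpha>\<close> by (intro mult_left_mono power_mono) auto
  ultimately show ?thesis
    using le unfolding \<mu> K(2) S_def[symmetric] D_def[symmetric] P_def \<sigma>_def K_def by linarith
qed

end
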